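(* Let $m>0$ and let $\lambda_1,\lambda_2,\lambda_3,\lambda_4$ be real with $\lambda_{12}:=\lambda_1+\lambda_2>0$ and $\Lambda:=\lambda_3+\lambda_4-\lambda_1-\lambda_2>0$. Let $\gamma_1\in\mathbb{R}$, $\gamma_1\neq 0$ (and $\gamma_2=\gamma_3=0$), be such that the numbers $$w_\pm=\frac{m}{\sqrt{2\lambda_{12}}}\sqrt{1\pm\sqrt{1-\frac{16\gamma_1^2\lambda_{12}^2}{m^4\Lambda^2}}}$$ are real and satisfy $w_+>w_-$ (so $w_+>w_->0$). Let $\varphi_0\in\mathbb{R}$ be any constant. Then there exist no smooth functions $\theta,\phi,\psi:\mathbb{R}\to\mathbb{R}$ and $W:\mathbb{R}\to \mathrm{SU}(3)$ that solve the one-dimensional sigma-model-limit domain-wall equations (E1)–(E5) listed in the context on all of $\mathbb{R}$ and obey the boundary conditions $$W(-\infty)=\mathbf{1}_3,\quad W(\infty)=\mathbf{1}_3,\qquad \psi(-\infty)=\varphi_0,\quad \psi(\infty)=0,$$ $$\phi(-\infty)=\varphi_0+\tfrac{\pi}{2}\bigl(1+\operatorname{sign}(\gamma_1)\bigr),\quad \phi(\infty)=\tfrac{\pi}{2}\bigl(1-\operatorname{sign}(\gamma_1)\bigr),\qquad \theta(-\infty)=0,\quad \theta(\infty)=\tfrac{\pi}{2}.$$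
   Context: Primes denote $d/dx$, $\mathbf{1}_3$ is the $3\times 3$ identity matrix, and $f(\pm\infty):=\lim_{x\to\pm\infty}f(x)$. Background: the fields are $\Phi_L=(w_+\cos\theta-w_-\sin\theta)\,e^{i\psi}\,W$ and $\Phi_R=(w_+\sin\theta+w_-\cos\theta)\,e^{i\phi}\,\mathbf{1}_3$. Write $S(\theta):=(w_+^2-w_-^2)\sin(2\theta)+2w_+w_-\cos(2\theta)$. With $\gamma_2=\gamma_3=0$, the equations are, for all $x\in\mathbb{R}$: (E1) $\displaystyle -\frac{1}{w_+^2+w_-^2}\Bigl(S(\theta)^2\,W'W^\dagger\Bigr)'+\gamma_1 S(\theta)\Bigl(We^{-i(\phi-\psi)}-W^\dagger e^{i(\phi-\psi)}\Bigr)=0$ (an equation of $3\times3$ complex matrices); (E2) $\displaystyle \Bigl((w_+\cos\theta-w_-\sin\theta)^2\,\psi'\Bigr)'=0$; (E3) $\displaystyle \Bigl((w_+\sin\theta+w_-\cos\theta)^2\,\phi'\Bigr)'=0$; (E4) $\displaystyle \gamma_1 S(\theta)\,\mathrm{Tr}\Bigl[We^{-i(\phi-\psi)}-W^\dagger e^{i(\phi-\psi)}\Bigr]=0$; (E5) $\displaystyle -\theta''+\frac{Q(\theta)}{12(w_+^2+w_-^2)^2}\mathrm{Tr}\bigl[(W')^\dagger W'\bigr]+\frac{S(\theta)}{2(w_+^2+w_-^2)}\bigl((\phi')^2-(\psi')^2\bigr)+\Lambda\,\frac{Q(\theta)}{8(w_+^2+w_-^2)}$ $\displaystyle\qquad+\gamma_1\frac{(w_+^2-w_-^2)\cos(2\theta)-2w_+w_-\sin(2\theta)}{6(w_+^2+w_-^2)}\,\mathrm{Tr}\Bigl[W^\dagger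 e^{i(\phi-\psi)}+We^{-i(\phi-\psi)}\Bigr]=0$, where $Q(\theta):=(w_+^4+w_-^4-6w_+^2w_-^2)\sin(4\theta)+4(w_+^2-w_-^2)w_+w_-\cos(4\theta)$. *)

theory Defs
  imports "HOL-Analysis.Analysis"
begin

type_synonym cmat3 = "complex ^ 3 ^ 3"

definition ddx :: "(real \<Rightarrow> 'a::real_normed_vector) \<Rightarrow> real \<Rightarrow> 'a" where
  "ddx f x = vector_derivative f (at x)"

definition smooth_real :: "(real \<Rightarrow> 'a::real_normed_vector) \<Rightarrow> bool" where
  "smooth_real f \<longleftrightarrow> (\<forall>n x. (ddx ^^ n) f differentiable (at x))"

definition dagger :: "cmat3 \<Rightarrow> cmat3" where
  "dagger A = transpose (map_matrix cnj A)"

definition cscale :: "complex \<Rightarrow> cmat3 \<Rightarrow> cmat3" (infixr "*\<^sub>M" 75) where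
  "c *\<^sub>M A = map_matrix ((*) c) A"

definition SU3 :: "cmat3 set" where
  "SU3 = {A. A ** dagger A = mat 1 \<and> dagger A ** A = mat 1 \<and> det A = 1}"

definition S_fun :: "real \<Rightarrow> real \<Rightarrow> real \<Rightarrow> real" where
  "S_fun wp wm t = (wp\<^sup>2 - wm\<^sup>2) * sin (2 * t) + 2 * wp * wm * cos (2 * t)"

definition Q_fun :: "real \<Rightarrow> real \<Rightarrow> real \<Rightarrow> real" where
  "Q_fun wp wm t = (wp^4 + wm^4 - 6 * wp\<^sup>2 * wm\<^sup>2) * sin (4 * t)
     + 4 * (wp\<^sup>2 - wm\<^sup>2) * wp * wm * cos (4 * t)"

definition eq_E1 :: "real \<Rightarrow> real \<Rightarrow> real \<Rightarrow> (real \<Rightarrow> real) \<Rightarrow> (real \<Rightarrow> real) \<Rightarrow> (real \<Rightarrow> real)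
    \<Rightarrow> (real \<Rightarrow> cmat3) \<Rightarrow> real \<Rightarrow> bool" where
  "eq_E1 wp wm g1 \<theta> \<phi> \<psi> W x \<longleftrightarrow>
     (- 1 / (wp\<^sup>2 + wm\<^sup>2)) *\<^sub>R
        ddx (\<lambda>y. (S_fun wp wm (\<theta> y))\<^sup>2 *\<^sub>R (ddx W y ** dagger (W y))) x
     + (g1 * S_fun wp wm (\<theta> x)) *\<^sub>R
        (cis (- (\<phi> x - \<psi> x)) *\<^sub>M W x - cis (\<phi> x - \<psi> x) *\<^sub>M dagger (W x)) = 0"

definition eq_E2 :: "real \<Rightarrow> real \<Rightarrow> (real \<Rightarrow> real) \<Rightarrow> (real \<Rightarrow> real) \<Rightarrow> real \<Rightarrow> bool" where
  "eq_E2 wp wm \<theta> \<psi> x \<longleftrightarrow>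
     ddx (\<lambda>y. (wp * cos (\<theta> y) - wm * sin (\<theta> y))\<^sup>2 * ddx \<psi> y) x = 0"

definition eq_E3 :: "real \<Rightarrow> real \<Rightarrow> (real \<Rightarrow> real) \<Rightarrow> (real \<Rightarrow> real) \<Rightarrow> real \<Rightarrow> bool" where
  "eq_E3 wp wm \<theta> \<phi> x \<longleftrightarrow>
     ddx (\<lambda>y. (wp * sin (\<theta> y) + wm * cos (\<theta> y))\<^sup>2 * ddx \<phi> y) x = 0"

definition eq_E4 :: "real \<Rightarrow> real \<Rightarrow> real \<Rightarrow> (real \<Rightarrow> real) \<Rightarrow> (real \<Rightarrow> real) \<Rightarrow> (real \<Rightarrow> real)
    \<Rightarrow> (real \<Rightarrow> cmat3) \<Rightarrow> real \<Rightarrow> bool" where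
  "eq_E4 wp wm g1 \<theta> \<phi> \<psi> W x \<longleftrightarrow>
     complex_of_real (g1 * S_fun wp wm (\<theta> x)) *
       trace (cis (- (\<phi> x - \<psi> x)) *\<^sub>M W x - cis (\<phi> x - \<psi> x) *\<^sub>M dagger (W x)) = 0"

(* An equation in the complex numbers, because the matrix traces are complex. *)
definition eq_E5 :: "real \<Rightarrow> real \<Rightarrow> real \<Rightarrow> real \<Rightarrow> (real \<Rightarrow> real) \<Rightarrow> (real \<Rightarrow> real) \<Rightarrow> (real \<Rightarrow> real)
    \<Rightarrow> (real \<Rightarrow> cmat3) \<Rightarrow> real \<Rightarrow> bool" where
  "eq_E5 wp wm Lam g1 \<theta> \<phi> \<psi> W x \<longleftrightarrow>
     - complex_of_real (ddx (ddx \<theta>) x)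
     + complex_of_real (Q_fun wp wm (\<theta> x) / (12 * (wp\<^sup>2 + wm\<^sup>2)\<^sup>2)) *
         trace (dagger (ddx W x) ** ddx W x)
     + complex_of_real (S_fun wp wm (\<theta> x) / (2 * (wp\<^sup>2 + wm\<^sup>2)) *
         ((ddx \<phi> x)\<^sup>2 - (ddx \<psi> x)\<^sup>2))
     + complex_of_real (Lam * (Q_fun wp wm (\<theta> x) / (8 * (wp\<^sup>2 + wm\<^sup>2))))
     + complex_of_real (g1 * (((wp\<^sup>2 - wm\<^sup>2) * cos (2 * \<theta> x) - 2 * wp * wm * sin (2 * \<theta> x))
           / (6 * (wp\<^sup>2 + wm\<^sup>2)))) *
         trace (cis (\<phi> x - \<psi> x) *\<^sub>M dagger (W x) + cis (- (\<phi> x - \<psi> x)) *\<^sub>M W x) = 0"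

definition domain_wall_solution :: "real \<Rightarrow> real \<Rightarrow> real \<Rightarrow> real \<Rightarrow> (real \<Rightarrow> real) \<Rightarrow> (real \<Rightarrow> real)
    \<Rightarrow> (real \<Rightarrow> real) \<Rightarrow> (real \<Rightarrow> cmat3) \<Rightarrow> bool" where
  "domain_wall_solution wp wm Lam g1 \<theta> \<phi> \<psi> W \<longleftrightarrow>
     (\<forall>x. eq_E1 wp wm g1 \<theta> \<phi> \<psi> W x \<and> eq_E2 wp wm \<theta> \<psi> x \<and> eq_E3 wp wm \<theta> \<phi> x \<and>
          eq_E4 wp wm g1 \<theta> \<phi> \<psi> W x \<and> eq_E5 wp wm Lam g1 \<theta> \<phi> \<psi> W x)"

end

(* Write S = 2 P R with P = w_+ cos \<theta> - w_- sin \<theta> and R = w_+ sin \<theta> + w_- cos \<theta>. By (E2), P^2 \<psi>' is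
   constant, and P has a zero because it changes sign, so P^2 \<psi>' = 0; by (E3), R^2 \<phi>' is a constant,
   which must be 0 because R is bounded and \<phi> converges. Hence (\<phi> - \<psi>)' vanishes wherever S does not.
   The boundary values of \<phi> - \<psi> at the two ends differ by \<plusminus>\<pi>, so (\<phi> - \<psi>)' cannot vanish identically,
   and S must vanish on a whole interval; let a be its left end. There \<theta> is constant,
   and (E5) gives Re Tr V = 0 for V = W e^{-i(\<phi> - \<psi>)}. To the left of a, (E1) says that the flux S^2 W' W^H
   is driven by S (V - V^H). As S and S' vanish at a, the flux is too small near a unless V - V^H = 0
   there. So V(a) is a unitary Hermitian 3 x 3 matrix, i.e. an involution, of trace 0; but the trace of
   such an involution is an odd integer. *)
theory Submission
  imports Defs
begin

section \<open>Flux near a degenerate zero of its weight\<close>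

text \<open>The flux \<open>S^2 * B\<close> and the comparison function \<open>C * S^2\<close> both
  vanish at a zero of \<open>S\<close>. If \<open>H a\<close> were nonzero, then going back from a
  zero near \<open>a\<close> the flux would grow faster in size than \<open>C * S^2\<close>,
  contrary to \<open>\<bar>B\<bar> < C\<close>.\<close>

lemma degenerate_flux_zero:
  fixes S S' B H :: "real \<Rightarrow> real"
  assumes dS: "\<And>x. (S has_real_derivative S' x) (at x)"
    and dF: "\<And>x. ((\<lambda>y. (S y)\<^sup>2 * B y) has_real_derivative S x * H x) (at x)"
    and cont: "isCont S' a" "isCont B a" "isCont H a"
    and zero: "S a = 0" "S' a = 0"
    and nonzero: "\<And>e. e > 0 \<Longrightarrow> \<exists>x. a - e < x \<and> x < a \<and> S x \<noteq> 0"
  shows "H a = 0"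
proof (rule ccontr)
  assume Ha: "H a \<noteq> 0"
  \<comment> \<open>Near \<open>a\<close>, \<open>k\<close> is a lower bound for the size of
    \<open>H\<close> and \<open>C\<close> an upper bound for that of \<open>B\<close>. The threshold
    \<open>k / (2 * C)\<close> for \<open>S'\<close> below keeps the derivative
    \<open>2 * C * S * S'\<close> of \<open>C * S^2\<close> smaller in size than
    \<open>k * \<bar>S\<bar>\<close> wherever \<open>S\<close> is nonzero.\<close>
  define k C where "k = \<bar>H a\<bar> / 2" and "C = \<bar>B a\<bar> + 1"
  have k: "k > 0" and C: "C > 0"
    using Ha by (auto simp: k_def C_def)
  have "\<forall>\<^sub>F y in at a. \<bar>B y\<bar> < C"
    using tendsto_rabs[OF cont(2)[unfolded isCont_def]] by (rule order_tendstoD) (simp add: C_def)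
  moreover have "\<forall>\<^sub>F y in at a. \<bar>S' y\<bar> < k / (2 * C)"
    using tendsto_rabs[OF cont(1)[unfolded isCont_def]]
    by (rule order_tendstoD) (use k C zero in simp)
  moreover have "\<forall>\<^sub>F y in at a. k < sgn (H a) * H y"
    using tendsto_mult[OF tendsto_const cont(3)[unfolded isCont_def], of "sgn (H a)"]
    by (rule order_tendstoD) (use Ha in \<open>auto simp: k_def sgn_if\<close>)
  ultimately have "\<forall>\<^sub>F y in at a. \<bar>B y\<bar> < C \<and> \<bar>S' y\<bar> < k / (2 * C) \<and> k < sgn (H a) * H y"
    by eventually_elim auto
  then obtain e where e: "e > 0" and
    near: "\<And>y. y \<noteq> a \<Longrightarrow> dist y a < e \<Longrightarrow> \<bar>B y\<bar> < C \<and> \<bar>S' y\<bar> < k / (2 * C) \<and> k < sgn (H a) * H y"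
    unfolding eventually_at by auto
  obtain x where x: "a - e < x" "x < a" "S x \<noteq> 0"
    using nonzero[OF e] by auto
  have contS: "continuous_on A S" for A
    using dS by (meson DERIV_isCont continuous_at_imp_continuous_on)
  \<comment> \<open>Zeros of \<open>S\<close> may accumulate at \<open>a\<close>, so the comparison
    runs only up to the first zero \<open>q\<close> after \<open>x\<close>. On the way there
    \<open>S\<close> keeps the sign \<open>s\<close>.\<close>
  have "compact {y\<in>{x..a}. S y = 0}"
    using continuous_closed_preimage_constant[OF contS, of "{x..a}" 0]
    by (simp add: compact_eq_bounded_closed bounded_subset[of "{x..a}"] subset_iff)
  moreover have "a \<in> {y\<in>{x..a}. S y = 0}"
    using x zero by auto
  ultimately obtain q where q: "q \<in> {x..a}" "S q = 0"
      and q_min: "\<And>y. y \<in> {x..a} \<Longrightarrow> S y = 0 \<Longrightarrow> q \<le> y"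
    using compact_attains_inf[of "{y\<in>{x..a}. S y = 0}"] by auto
  have xq: "x < q"
    using q x by (cases "x = q") auto
  define s where "s = sgn (S x)"
  have ss: "s * s = 1"
    using x by (simp add: s_def sgn_if)
  have pos: "s * S y > 0" if y: "x \<le> y" "y < q" for y
  proof (rule ccontr)
    assume "\<not> s * S y > 0"
    moreover have "s * S x > 0"
      using x by (auto simp: s_def sgn_if)
    moreover have "continuous_on {x..y} (\<lambda>z. s * S z)"
      by (intro continuous_intros contS)
    ultimately obtain z where "x \<le> z" "z \<le> y" "s * S z = 0"
      using IVT2'[of "\<lambda>z. s * S z" y 0 x] y by auto
    then show False
      using q_min[of z] y q x by (auto simp: s_def sgn_if split: if_splits)
  qed
  \<comment> \<open>This sign makes \<open>\<tau> * (S y * H y)\<close> the product of the positive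
    factors \<open>s * S y\<close> and \<open>sgn (H a) * H y\<close> for \<open>y\<close> between
    \<open>x\<close> and \<open>q\<close>.\<close>
  define \<tau> where "\<tau> = sgn (H a) * s"
  have \<tau>: "\<bar>\<tau>\<bar> = 1"
    using Ha x by (simp add: \<tau>_def s_def abs_mult sgn_if)
  \<comment> \<open>Near \<open>a\<close> the flux changes at rate at least \<open>k * \<bar>S\<bar>\<close>, while \<open>C * S\<^sup>2\<close>, which dominates it,
    changes more slowly because \<open>S'\<close> is small.\<close>
  define g where "g y = \<tau> * ((S y)\<^sup>2 * B y) + C * (S y)\<^sup>2" for y
  have dg: "(g has_real_derivative \<tau> * (S y * H y) + C * (2 * S y * S' y)) (at y)" for y
  proof -
    have "((\<lambda>y. C * (S y)\<^sup>2) has_real_derivative C * (2 * S y * S' y)) (at y)"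
      by (auto intro!: derivative_eq_intros dS)
    then show ?thesis
      unfolding g_def by (intro DERIV_add DERIV_cmult[OF dF])
  qed
  have "g x < g q"
  proof (rule DERIV_pos_imp_increasing_open[OF xq])
    fix y assume y: "x < y" "y < q"
    have n: "\<bar>S' y\<bar> < k / (2 * C)" "k < sgn (H a) * H y"
      using near[of y] y x q by (auto simp: dist_real_def)
    have "2 * C * \<bar>S' y\<bar> < k"
      using n C by (simp add: field_simps)
    moreover have "\<bar>s\<bar> = 1"
      using x by (simp add: s_def sgn_if)
    then have "\<bar>s * S' y\<bar> = \<bar>S' y\<bar>"
      by (simp add: abs_mult)
    then have "- \<bar>S' y\<bar> \<le> s * S' y"
      by linarith
    then have "2 * C * - \<bar>S' y\<bar> \<le> 2 * C * (s * S' y)"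
      by (rule mult_left_mono) (use C in simp)
    ultimately have "0 < sgn (H a) * H y + 2 * C * (s * S' y)"
      using n by linarith
    then have "0 < (s * S y) * (sgn (H a) * H y + 2 * C * (s * S' y))"
      using pos[of y] y by (simp del: mult_pos_pos add: mult_pos_pos)
    also have "\<dots> = \<tau> * (S y * H y) + C * (2 * S y * S' y) * (s * s)"
      by (simp add: \<tau>_def algebra_simps)
    finally show "\<exists>D. (g has_real_derivative D) (at y) \<and> D > 0"
      using dg ss by auto
  qed (meson dg DERIV_isCont continuous_at_imp_continuous_on)
  moreover have "g q = 0"
    by (simp add: g_def q)
  moreover have "g x = (S x)\<^sup>2 * (\<tau> * B x + C)"
    by (simp add: g_def algebra_simps)
  moreover have "\<bar>\<tau> * B x\<bar> < C"
    using near[of x] x \<tau> by (auto simp: dist_real_def abs_mult)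
  then have "0 \<le> (S x)\<^sup>2 * (\<tau> * B x + C)"
    by (intro mult_nonneg_nonneg) auto
  ultimately show False
    by simp
qed

section \<open>Matrix algebra in dimension three\<close>

lemma bounded_bilinear_cmat3: "bounded_bilinear ((**) :: cmat3 \<Rightarrow> cmat3 \<Rightarrow> cmat3)"
  unfolding bilinear_conv_bounded_bilinear[symmetric] bilinear_def
  by (auto intro!: linearI simp: vec_eq_iff matrix_matrix_mult_def scaleR_sum_right
      sum.distrib algebra_simps)

text \<open>The three eigenvalues are 1 or -1, so their sum is odd. The proof works with the
  coefficients of the characteristic polynomial instead of eigenvalues.\<close>

lemma involution_3_trace_nonzero:
  fixes V :: cmat3
  assumes inv: "V ** V = mat 1"
  shows "trace V \<noteq> 0"
proof
  assume tr: "trace V = 0"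
  define d where "d = det V"
  have d2: "d * d = 1"
    using arg_cong[OF inv, of det] by (simp add: det_mul d_def)
  have e: "trace (V ** V) = 3"
    unfolding inv by (simp add: trace_def mat_def)
  \<comment> \<open>The sum of the principal 2 x 2 minors, which is the second elementary symmetric
    function of the eigenvalues.\<close>
  define e2 where "e2 = V$1$1 * V$2$2 - V$1$2 * V$2$1 + V$1$1 * V$3$3 - V$1$3 * V$3$1
      + V$2$2 * V$3$3 - V$2$3 * V$3$2"
  have "(trace V)\<^sup>2 = trace (V ** V) + 2 * e2"
    by (simp add: trace_def matrix_matrix_mult_def sum_3 e2_def power2_eq_square algebra_simps)
  then have e2: "2 * e2 = -3"
    using tr e by (simp add: add_eq_0_iff)
  have m: "det (V - mat 1) = d - e2 + trace V - 1"
    by (simp add: d_def det_3 mat_def trace_def sum_3 e2_def algebra_simps)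
  have p: "det (V + mat 1) = d + e2 + trace V + 1"
    by (simp add: d_def det_3 mat_def trace_def sum_3 e2_def algebra_simps)
  have "(V - mat 1) ** (V + mat 1) = 0"
    using inv by (simp add: matrix_add_ldistrib bounded_bilinear.diff_left[OF bounded_bilinear_cmat3])
  then have "det (V - mat 1) * det (V + mat 1) = 0"
    by (metis det_mul det_0 mat_0)
  \<comment> \<open>With trace 0 and \<open>e2\<close> equal to -3/2, the two determinants are
    \<open>d + 1/2\<close> and \<open>d - 1/2\<close>. One of them vanishes, which is incompatible
    with \<open>d * d = 1\<close>.\<close>
  then have "(2 * d + 1) * (2 * d - 1) = 0"
    using m p tr e2 by algebra
  then show False
    using d2 by algebra
qed

lemma bounded_linear_dagger: "bounded_linear dagger"
  unfolding linear_conv_bounded_linear[symmetric] dagger_def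
  by (auto intro!: linearI simp: vec_eq_iff transpose_def map_matrix_def)

lemma dagger_cscale: "dagger (c *\<^sub>M A) = cnj c *\<^sub>M dagger A"
  by (simp add: dagger_def cscale_def vec_eq_iff transpose_def map_matrix_def)

lemma cscale_mult: "(c *\<^sub>M A) ** (d *\<^sub>M B) = (c * d) *\<^sub>M (A ** B)"
  by (simp add: cscale_def vec_eq_iff map_matrix_def matrix_matrix_mult_def sum_distrib_left algebra_simps)

section \<open>Continuity, derivatives and limits\<close>

lemma isCont_cscale:
  assumes "isCont c x" "isCont A x"
  shows "isCont (\<lambda>y. c y *\<^sub>M A y) x"
  unfolding cscale_def map_matrix_def continuous_at
  by (intro vec_tendstoI) (use assms in \<open>auto intro!: tendsto_intros simp: continuous_at\<close>)

lemma isCont_cis: "isCont f x \<Longrightarrow> isCont (\<lambda>y. cis (f y)) x"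
  unfolding isCont_def by (rule tendsto_cis)

lemma smooth_real_has_vector_derivative:
  assumes "smooth_real f"
  shows "(f has_vector_derivative ddx f x) (at x)"
  using assms[unfolded smooth_real_def, rule_format, of 0 x]
  by (simp add: ddx_def vector_derivative_works)

lemma smooth_real_ddx: "smooth_real f \<Longrightarrow> smooth_real (ddx f)"
  unfolding smooth_real_def by (metis funpow_Suc_right o_apply)

lemma smooth_real_isCont: "smooth_real f \<Longrightarrow> isCont f x"
  using has_vector_derivative_continuous smooth_real_has_vector_derivative by blast

lemma has_vector_derivative_ddx:
  "f differentiable (at x) \<Longrightarrow> (f has_vector_derivative ddx f x) (at x)"
  by (simp add: ddx_def vector_derivative_works)

lemma ddx_eventually_zero:
  assumes "open A" "x \<in> A" "\<And>y. y \<in> A \<Longrightarrow> f y = 0"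
  shows "ddx f x = 0"
proof -
  have "(f has_vector_derivative 0) (at x)"
    by (rule has_vector_derivative_transform_within_open[of "\<lambda>_. 0", OF _ assms(1,2)]) 
      (use assms(3) in auto)
  then show ?thesis
    by (simp add: ddx_def vector_derivative_at)
qed

lemma ddx_zero_imp_const:
  fixes f :: "real \<Rightarrow> real"
  assumes "\<And>x. f differentiable (at x)" "\<And>x. ddx f x = 0"
  shows "f x = f y"
proof -
  have "(f has_real_derivative 0) (at x)" for x
    using has_vector_derivative_ddx[OF assms(1)] assms(2)
    by (simp add: has_real_derivative_iff_has_vector_derivative)
  then show ?thesis
    by (intro DERIV_isconst_all) auto
qed

lemma smooth_real_has_real_derivative:
  "smooth_real f \<Longrightarrow> (f has_real_derivative ddx f x) (at x)"
  by (simp add: has_real_derivative_iff_has_vector_derivative smooth_real_has_vector_derivative)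

text \<open>Carries identities from the interval on which \<open>S\<close> vanishes to its left end,
  by uniqueness of the one-sided limit.\<close>

lemma isCont_eq_zero_left_endpoint:
  fixes f :: "real \<Rightarrow> 'a::{t2_space,zero}"
  assumes "a < b" "isCont f a" "\<And>y. y \<in> {a<..<b} \<Longrightarrow> f y = 0"
  shows "f a = 0"
proof -
  have "(f \<longlongrightarrow> f a) (at_right a)"
    using assms(2) by (simp add: isCont_def filterlim_at_split)
  moreover have "\<forall>\<^sub>F y in at_right a. f y = 0"
    using eventually_at_right_less[of a] order_tendstoD(2)[OF tendsto_ident_at assms(1)]
    by eventually_elim (use assms(3) in auto)
  then have "(f \<longlongrightarrow> 0) (at_right a)"
    by (rule tendsto_eventually)
  ultimately show ?thesis
    by (rule tendsto_unique[OF trivial_limit_at_right_real])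
qed

text \<open>Otherwise, by the mean value theorem, \<open>f\<close> would stay above a line of slope
  \<open>c\<close> on the positive axis and tend to infinity.\<close>

lemma derivative_not_bounded_below_if_convergent:
  fixes f f' :: "real \<Rightarrow> real"
  assumes d: "\<And>x. (f has_real_derivative f' x) (at x)"
    and lim: "(f \<longlongrightarrow> l) at_top" and c: "c > 0"
  shows "\<exists>x. f' x < c"
proof (rule ccontr)
  assume "\<not> ?thesis"
  then have ge: "f' x \<ge> c" for x
    by (simp add: not_less)
  have "f 0 + c * x \<le> f x" if x: "x > 0" for x
  proof -
    obtain z where "f x - f 0 = (x - 0) * f' z"
      using MVT2[OF x d] by blast
    moreover have "c * x \<le> f' z * x"
      using ge[of z] x by (intro mult_right_mono) auto
    ultimately show ?thesis
      by (simp add: algebra_simps)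
  qed
  then have "\<forall>\<^sub>F x in at_top. f 0 + c * x \<le> f x"
    by (auto intro: eventually_mono[OF eventually_gt_at_top[of 0]])
  moreover have "filterlim (\<lambda>x. f 0 + c * x) at_top at_top"
    by (intro filterlim_tendsto_add_at_top[OF tendsto_const] 
        filterlim_tendsto_pos_mult_at_top[OF tendsto_const c filterlim_ident])
  ultimately have "filterlim f at_top at_top"
    by (rule filterlim_at_top_mono[rotated])
  then show False
    using not_tendsto_and_filterlim_at_infinity[OF trivial_limit_at_top_linorder lim]
      filterlim_at_top_imp_at_infinity[of f at_top] by simp
qed

section \<open>Constancy of the phase difference\<close>

lemma phase_difference_constant:
  fixes \<theta> \<phi> \<psi> :: "real \<Rightarrow> real" and W :: "real \<Rightarrow> cmat3"
  assumes w: "wm > 0" "wp > wm" and g1: "g1 \<noteq> 0"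
    and sm: "smooth_real \<theta>" "smooth_real \<phi>" "smooth_real \<psi>" "smooth_real W"
    and SU3: "\<And>x. W x \<in> SU3"
    and sol: "domain_wall_solution wp wm Lam g1 \<theta> \<phi> \<psi> W"
    and \<phi>_top: "(\<phi> \<longlongrightarrow> l) at_top"
    and \<theta>_bot: "(\<theta> \<longlongrightarrow> 0) at_bot" and \<theta>_top: "(\<theta> \<longlongrightarrow> pi / 2) at_top"
  shows "ddx \<phi> x = ddx \<psi> x"
proof (rule ccontr)
  assume x: "ddx \<phi> x \<noteq> ddx \<psi> x"
  note E = sol[unfolded domain_wall_solution_def, rule_format]
  define N where "N = wp\<^sup>2 + wm\<^sup>2"
  \<comment> \<open>With \<alpha> the polar angle of the point (\<open>wp\<close>,
    \<open>wm\<close>), \<open>P\<close> and \<open>R\<close> are sqrt N times the cosine and sine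
    of \<theta> + \<alpha>, while \<open>S\<close> and \<open>C\<close> are N times the sine and
    cosine of 2 (\<theta> + \<alpha>). The identities below are the double-angle and Pythagorean
    formulas for these angles.\<close>
  define P where "P y = wp * cos (\<theta> y) - wm * sin (\<theta> y)" for y
  define R where "R y = wp * sin (\<theta> y) + wm * cos (\<theta> y)" for y
  define S where "S y = S_fun wp wm (\<theta> y)" for y
  define C where "C y = (wp\<^sup>2 - wm\<^sup>2) * cos (2 * \<theta> y) - 2 * wp * wm * sin (2 * \<theta> y)" for y
  have N: "N > 0"
    using w by (simp add: N_def sum_power2_gt_zero_iff)
  have sc: "(sin (\<theta> y))\<^sup>2 + (cos (\<theta> y))\<^sup>2 = 1" for y
    by simp
  have PR: "(P y)\<^sup>2 + (R y)\<^sup>2 = N" for y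
    using sc[of y] unfolding P_def R_def N_def by algebra
  have S_PR: "S y = 2 * P y * R y" for y
    unfolding S_def S_fun_def P_def R_def sin_double cos_double by algebra
  have S_C: "(S y)\<^sup>2 + (C y)\<^sup>2 = N\<^sup>2" for y
    using sin_cos_squared_add[of "2 * \<theta> y"] unfolding S_def S_fun_def C_def N_def by algebra
  have Q_SC: "Q_fun wp wm (\<theta> y) = 2 * S y * C y" for y
  proof -
    have "sin (4 * \<theta> y) = 2 * sin (2 * \<theta> y) * cos (2 * \<theta> y)"
      "cos (4 * \<theta> y) = (cos (2 * \<theta> y))\<^sup>2 - (sin (2 * \<theta> y))\<^sup>2"
      using sin_double[of "2 * \<theta> y"] cos_double[of "2 * \<theta> y"] by simp_all
    then show ?thesis
      unfolding Q_fun_def S_def S_fun_def C_def by algebra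
  qed
  note d\<theta> = smooth_real_has_real_derivative[OF sm(1)]
  have dP: "(P has_real_derivative - R y * ddx \<theta> y) (at y)" for y
    unfolding P_def[abs_def] R_def by (auto intro!: derivative_eq_intros d\<theta> simp: algebra_simps)
  have dR: "(R has_real_derivative P y * ddx \<theta> y) (at y)" for y
    unfolding P_def R_def[abs_def] by (auto intro!: derivative_eq_intros d\<theta> simp: algebra_simps)
  have dS: "(S has_real_derivative 2 * C y * ddx \<theta> y) (at y)" for y
    unfolding S_def[abs_def] S_fun_def C_def
    by (auto intro!: derivative_eq_intros d\<theta> simp: algebra_simps)
  note d\<phi> = smooth_real_has_real_derivative[OF smooth_real_ddx[OF sm(2)]]
  note d\<psi> = smooth_real_has_real_derivative[OF smooth_real_ddx[OF sm(3)]]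

  have P\<psi>: "(P y)\<^sup>2 * ddx \<psi> y = 0" for y
  proof -
    have "(P \<longlongrightarrow> wp) at_bot"
      using tendsto_diff[OF tendsto_mult[OF tendsto_const tendsto_cos[OF \<theta>_bot]]
          tendsto_mult[OF tendsto_const tendsto_sin[OF \<theta>_bot]], of wp wm]
      by (simp add: P_def[abs_def])
    then have "\<forall>\<^sub>F y in at_bot. P y > 0"
      by (rule order_tendstoD) (use w in simp)
    then obtain b where b: "\<And>y. y \<le> b \<Longrightarrow> P y > 0"
      by (auto simp: eventually_at_bot_linorder)
    have "(P \<longlongrightarrow> - wm) at_top"
      using tendsto_diff[OF tendsto_mult[OF tendsto_const tendsto_cos[OF \<theta>_top]]
          tendsto_mult[OF tendsto_const tendsto_sin[OF \<theta>_top]], of wp wm]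
      by (simp add: P_def[abs_def])
    then have "\<forall>\<^sub>F y in at_top. P y < 0"
      by (rule order_tendstoD) (use w in simp)
    then obtain t where t: "\<And>y. y \<ge> t \<Longrightarrow> P y < 0"
      by (auto simp: eventually_at_top_linorder)
    \<comment> \<open>The left end is at most \<open>b\<close>, so \<open>P\<close> is positive
      there, and at most \<open>t\<close>, so the interval is nonempty.\<close>
    have "continuous_on {min b t..t} P"
      using dP by (meson DERIV_isCont continuous_at_imp_continuous_on)
    then obtain z where z: "P z = 0"
      using IVT2'[of P t 0 "min b t"] b[of "min b t"] t[of t] by force
    have "(P y)\<^sup>2 * ddx \<psi> y = (P z)\<^sup>2 * ddx \<psi> z"
    proof (rule ddx_zero_imp_const[of "\<lambda>y. (P y)\<^sup>2 * ddx \<psi> y"])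
      fix v
      show "(\<lambda>y. (P y)\<^sup>2 * ddx \<psi> y) differentiable (at v)"
        unfolding real_differentiable_def by (rule exI) (auto intro!: derivative_eq_intros dP d\<psi>)
      show "ddx (\<lambda>y. (P y)\<^sup>2 * ddx \<psi> y) v = 0"
        using E[of v] by (simp add: eq_E2_def P_def)
    qed
    then show ?thesis
      by (simp add: z)
  qed

  \<comment> \<open>\<open>R\<close> has positive limits at both ends, so no sign change is at hand.
    Instead, a nonzero constant \<open>d\<close> together with \<open>R^2 \<le> N\<close> would
    force \<open>sgn d * \<phi>'\<close> to be at least \<open>\<bar>d\<bar> / N\<close> everywhere,
    against the convergence of \<open>\<phi>\<close>.\<close>
  have R\<phi>: "(R y)\<^sup>2 * ddx \<phi> y = 0" for y
  proof (rule ccontr)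
    assume "(R y)\<^sup>2 * ddx \<phi> y \<noteq> 0"
    moreover define d where "d = (R y)\<^sup>2 * ddx \<phi> y"
    ultimately have d: "d \<noteq> 0"
      by simp
    have const: "(R z)\<^sup>2 * ddx \<phi> z = d" for z
      unfolding d_def
    proof (rule ddx_zero_imp_const[of "\<lambda>y. (R y)\<^sup>2 * ddx \<phi> y"])
      fix v
      show "(\<lambda>y. (R y)\<^sup>2 * ddx \<phi> y) differentiable (at v)"
        unfolding real_differentiable_def by (rule exI) (auto intro!: derivative_eq_intros dR d\<phi>)
      show "ddx (\<lambda>y. (R y)\<^sup>2 * ddx \<phi> y) v = 0"
        using E[of v] by (simp add: eq_E3_def R_def)
    qed
    have "\<exists>v. sgn d * ddx \<phi> v < \<bar>d\<bar> / N"
    proof (rule derivative_not_bounded_below_if_convergent)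
      show "((\<lambda>v. sgn d * \<phi> v) has_real_derivative sgn d * ddx \<phi> v) (at v)" for v
        by (intro DERIV_cmult smooth_real_has_real_derivative sm)
      show "((\<lambda>v. sgn d * \<phi> v) \<longlongrightarrow> sgn d * l) at_top"
        by (intro tendsto_intros \<phi>_top)
    qed (use d N in auto)
    then obtain v where v: "sgn d * ddx \<phi> v < \<bar>d\<bar> / N"
      by auto
    have Rv: "(R v)\<^sup>2 \<le> N"
      using PR[of v] zero_le_power2[of "P v"] by linarith
    have eq: "(R v)\<^sup>2 * (sgn d * ddx \<phi> v) = \<bar>d\<bar>"
      using const[of v] by (metis abs_sgn mult.left_commute mult.commute)
    then have "sgn d * ddx \<phi> v > 0"
      using d by (metis abs_ge_zero less_eq_real_def mult_nonneg_nonpos not_less zero_le_power2 zero_less_abs_iff order_antisym)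
    then have "\<bar>d\<bar> \<le> N * (sgn d * ddx \<phi> v)"
      using eq Rv by (metis less_imp_le mult_right_mono)
    then show False
      using v N by (simp add: field_simps)
  qed

  have S_zero: "S y = 0" if "ddx \<phi> y \<noteq> ddx \<psi> y" for y
    using P\<psi>[of y] R\<phi>[of y] that by (auto simp: S_PR)

  \<comment> \<open>A whole neighbourhood of \<open>x\<close> is secured so that the supremum
    \<open>a\<close> below lies strictly left of \<open>x\<close>.\<close>
  obtain e where e: "e > 0" "\<And>y. \<bar>y - x\<bar> < e \<Longrightarrow> S y = 0"
  proof -
    have "isCont (\<lambda>y. ddx \<phi> y - ddx \<psi> y) x"
      by (intro continuous_intros smooth_real_isCont smooth_real_ddx sm)
    then have "\<forall>\<^sub>F y in nhds x. ddx \<phi> y - ddx \<psi> y \<noteq> 0"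
      using x tendsto_imp_eventually_ne[of "\<lambda>y. ddx \<phi> y - ddx \<psi> y" _ "at x" 0]
      by (simp add: isCont_def eventually_nhds_conv_at)
    then show ?thesis
      using S_zero that by (auto simp: eventually_nhds_metric dist_real_def)
  qed

  \<comment> \<open>The supremum of \<open>Z\<close> is the left end of the zero interval of
    \<open>S\<close> that reaches \<open>x\<close>. It exists because \<open>S\<close> has a
    positive limit at minus infinity.\<close>
  define Z where "Z = {y. y \<le> x \<and> S y \<noteq> 0}"
  have "(S \<longlongrightarrow> 2 * wp * wm) at_bot"
    unfolding S_def[abs_def] S_fun_def
    by (rule tendsto_eq_intros \<theta>_bot refl | simp)+
  then have "\<forall>\<^sub>F y in at_bot. S y > 0"
    by (rule order_tendstoD) (use w in simp)
  then obtain b where b: "\<And>y. y \<le> b \<Longrightarrow> S y > 0"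
    by (auto simp: eventually_at_bot_linorder)
  have Z_ne: "min b x \<in> Z"
    using b[of "min b x"] by (simp add: Z_def)
  have Z_bdd: "bdd_above Z"
    unfolding Z_def by (intro bdd_aboveI[of _ x]) auto
  define a where "a = Sup Z"
  have Z_le: "y \<le> x - e" if "y \<in> Z" for y
    using that e(2)[of y] by (force simp: Z_def)
  have ax: "a < x"
    using cSup_least[of Z "x - e"] Z_ne Z_le e(1) unfolding a_def by fastforce
  have S0: "S y = 0" if "y \<in> {a<..<x}" for y
    using that cSup_upper[OF _ Z_bdd, of y] by (auto simp: a_def Z_def)
  note right_lim = isCont_eq_zero_left_endpoint[OF ax]
  have Sa: "S a = 0"
    by (rule right_lim[OF DERIV_isCont[OF dS] S0])
  \<comment> \<open>Where \<open>S\<close> vanishes, \<open>C\<close> is N or -N. So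
    \<open>S' = 2 * C * \<theta>'\<close> turns the vanishing of \<open>S'\<close> into that of
    \<open>\<theta>'\<close>.\<close>
  have C_ne: "C y \<noteq> 0" if "S y = 0" for y
    using S_C[of y] that N by auto
  have \<theta>'0: "ddx \<theta> y = 0" if y: "y \<in> {a<..<x}" for y
  proof -
    have "ddx S y = 0"
      by (rule ddx_eventually_zero[OF _ y]) (use S0 in auto)
    moreover have "ddx S y = 2 * C y * ddx \<theta> y"
      using dS[of y] by (simp add: ddx_def vector_derivative_at has_real_derivative_iff_has_vector_derivative)
    ultimately show ?thesis
      using C_ne[OF S0[OF y]] by simp
  qed
  have \<theta>'a: "ddx \<theta> a = 0"
    by (rule right_lim) (use \<theta>'0 smooth_real_isCont smooth_real_ddx sm in auto)
  have \<theta>''0: "ddx (ddx \<theta>) y = 0" if "y \<in> {a<..<x}" for y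
    by (rule ddx_eventually_zero[OF _ that]) (use \<theta>'0 in auto)

  define V where "V y = cis (- (\<phi> y - \<psi> y)) *\<^sub>M W y" for y
  have dV: "dagger (V y) = cis (\<phi> y - \<psi> y) *\<^sub>M dagger (W y)" for y
    by (simp add: V_def dagger_cscale cis_cnj)
  \<comment> \<open>On this interval \<theta>'', \<open>S\<close> and \<open>Q = 2 * S * C\<close>
    all vanish, so only the \<gamma>-term of (E5) survives, with the nonzero coefficient
    \<open>g1 * C / (6 * N)\<close>.\<close>
  have trV: "trace (dagger (V y) + V y) = 0" if y: "y \<in> {a<..<x}" for y
  proof -
    have "Q_fun wp wm (\<theta> y) = 0" "S_fun wp wm (\<theta> y) = 0"
      using S0[OF y] Q_SC[of y] by (simp_all add: S_def)
    then have "complex_of_real (g1 * (C y / (6 * N))) * trace (dagger (V y) + V y) = 0"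
      using E[of y] \<theta>''0[OF y] unfolding eq_E5_def dV by (simp add: C_def N_def V_def)
    moreover have "g1 * (C y / (6 * N)) \<noteq> 0"
      using g1 N C_ne[OF S0[OF y]] by simp
    ultimately show ?thesis
      by (metis mult_eq_0_iff of_real_eq_0_iff)
  qed
  have contV: "isCont V y" for y
    unfolding V_def[abs_def]
    by (intro isCont_cscale smooth_real_isCont[OF sm(4)] isCont_cis continuous_intros
        smooth_real_isCont[OF sm(2)] smooth_real_isCont[OF sm(3)])
  have cont_dag: "isCont (\<lambda>y. dagger (V y)) y" for y
    by (rule bounded_linear.isCont[OF bounded_linear_dagger contV])
  have trVa: "trace (dagger (V a) + V a) = 0"
  proof (rule right_lim)
    show "isCont (\<lambda>y. trace (dagger (V y) + V y)) a"
      unfolding trace_def isCont_def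
      by (intro tendsto_intros cont_dag[unfolded isCont_def] contV[unfolded isCont_def])
  qed (use trV in auto)

  define A where "A y = ddx W y ** dagger (W y)" for y
  have dA: "A differentiable (at y)" for y
    unfolding A_def[abs_def]
    by (rule differentiableI_vector, rule bounded_bilinear.has_vector_derivative[OF bounded_bilinear_cmat3],
        rule smooth_real_has_vector_derivative[OF smooth_real_ddx[OF sm(4)]],
        rule bounded_linear.has_vector_derivative[OF bounded_linear_dagger],
        rule smooth_real_has_vector_derivative[OF sm(4)])
  have dSA: "((\<lambda>y. (S y)\<^sup>2 *\<^sub>R A y) has_vector_derivative (S y * (N * g1)) *\<^sub>R (V y - dagger (V y))) (at y)" for y
  proof -
    have "(\<lambda>y. (S y)\<^sup>2 *\<^sub>R A y) differentiable (at y)"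
      using dS[of y] by (intro differentiable_scaleR differentiable_power dA)
        (auto simp: real_differentiable_def)
    note has_vector_derivative_ddx[OF this]
    moreover have "(- 1 / N) *\<^sub>R ddx (\<lambda>y. (S y)\<^sup>2 *\<^sub>R A y) y + (g1 * S y) *\<^sub>R (V y - dagger (V y)) = 0"
      using E[of y] unfolding eq_E1_def dV by (simp add: N_def S_def A_def V_def)
    then have "(g1 * S y) *\<^sub>R (V y - dagger (V y)) = (1 / N) *\<^sub>R ddx (\<lambda>y. (S y)\<^sup>2 *\<^sub>R A y) y"
      by simp
    from arg_cong[OF this, of "(*\<^sub>R) N"]
    have "(S y * (N * g1)) *\<^sub>R (V y - dagger (V y)) = ddx (\<lambda>y. (S y)\<^sup>2 *\<^sub>R A y) y"
      using N by (simp only: scaleR_scaleR) (simp add: mult_ac)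
    ultimately show ?thesis
      by simp
  qed
  \<comment> \<open>Pairing (E1) with this fixed matrix makes it scalar. At \<open>a\<close> the
    source becomes \<open>N * g1\<close> times the squared norm of \<open>K\<close>, so its
    vanishing gives \<open>K = 0\<close>.\<close>
  define K where "K = V a - dagger (V a)"
  have "N * g1 * ((V a - dagger (V a)) \<bullet> K) = 0"
  proof (rule degenerate_flux_zero[of S _ "\<lambda>y. A y \<bullet> K" "\<lambda>y. N * g1 * ((V y - dagger (V y)) \<bullet> K)" a])
    show "(S has_real_derivative 2 * C y * ddx \<theta> y) (at y)" for y
      by (rule dS)
    show "((\<lambda>y. (S y)\<^sup>2 * (A y \<bullet> K)) has_real_derivative
        S y * (N * g1 * ((V y - dagger (V y)) \<bullet> K))) (at y)" for y
      using bounded_linear.has_vector_derivative[OF bounded_linear_inner_left dSA[of y], of K]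
      by (simp add: has_real_derivative_iff_has_vector_derivative mult.assoc)
    show "isCont (\<lambda>y. 2 * C y * ddx \<theta> y) a"
      unfolding C_def[abs_def] by (intro continuous_intros smooth_real_isCont smooth_real_ddx sm)
    show "isCont (\<lambda>y. A y \<bullet> K) a"
      using dA by (intro continuous_intros differentiable_imp_continuous_within)
    show "isCont (\<lambda>y. N * g1 * ((V y - dagger (V y)) \<bullet> K)) a"
      by (intro continuous_intros contV cont_dag)
    \<comment> \<open>\<open>S a = 0\<close> keeps \<open>a\<close> out of \<open>Z\<close>, so
      points of \<open>Z\<close> approach the supremum strictly from the left.\<close>
    show "\<exists>z. a - r < z \<and> z < a \<and> S z \<noteq> 0" if "r > 0" for r
    proof -
      obtain z where "z \<in> Z" "a - r < z"
        using less_cSupD[of Z "a - r"] Z_ne \<open>r > 0\<close> unfolding a_def by auto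
      moreover have "z \<le> a" "S z \<noteq> 0"
        using \<open>z \<in> Z\<close> cSup_upper[OF _ Z_bdd, of z] by (auto simp: a_def Z_def)
      moreover have "z \<noteq> a"
        using \<open>S z \<noteq> 0\<close> Sa by auto
      ultimately show ?thesis
        by force
    qed
  qed (use Sa \<theta>'a in auto)
  then have herm: "dagger (V a) = V a"
    using N g1 by (simp add: K_def[symmetric]) (simp add: K_def)
  \<comment> \<open>Hermiticity turns unitarity into \<open>V^2 = 1\<close>, since the two phases
    cancel in the product.\<close>
  have "V a ** V a = V a ** dagger (V a)"
    by (simp add: herm)
  also have "\<dots> = 1 *\<^sub>M mat 1"
    using SU3[of a] unfolding dV unfolding V_def cscale_mult by (simp add: SU3_def cis_mult)
  finally have "V a ** V a = mat 1"
    by (simp add: cscale_def map_matrix_def vec_eq_iff)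
  moreover have "trace (V a) = 0"
    using trVa unfolding herm trace_add by simp
  ultimately show False
    using involution_3_trace_nonzero by blast
qed

section \<open>Contradiction from the boundary phases\<close>

theorem theorem1:
  fixes m l1 l2 l3 l4 l12 Lam g1 wp wm phi0 :: real
  assumes "m > 0"
    and "l12 = l1 + l2" and "l12 > 0"
    and "Lam = l3 + l4 - l1 - l2" and "Lam > 0"
    and "g1 \<noteq> 0"
    and "0 \<le> 1 - 16 * g1\<^sup>2 * l12\<^sup>2 / (m^4 * Lam\<^sup>2)"
    and "wp = m / sqrt (2 * l12) * sqrt (1 + sqrt (1 - 16 * g1\<^sup>2 * l12\<^sup>2 / (m^4 * Lam\<^sup>2)))"
    and "wm = m / sqrt (2 * l12) * sqrt (1 - sqrt (1 - 16 * g1\<^sup>2 * l12\<^sup>2 / (m^4 * Lam\<^sup>2)))"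
    and "wp > wm"
  shows "\<not> (\<exists>(\<theta> :: real \<Rightarrow> real) (\<phi> :: real \<Rightarrow> real) (\<psi> :: real \<Rightarrow> real) (W :: real \<Rightarrow> cmat3).
      smooth_real \<theta> \<and> smooth_real \<phi> \<and> smooth_real \<psi> \<and>
      smooth_real W \<and> (\<forall>x. W x \<in> SU3) \<and>
      domain_wall_solution wp wm Lam g1 \<theta> \<phi> \<psi> W \<and>
      (W \<longlongrightarrow> mat 1) at_bot \<and> (W \<longlongrightarrow> mat 1) at_top \<and>
      (\<psi> \<longlongrightarrow> phi0) at_bot \<and> (\<psi> \<longlongrightarrow> 0) at_top \<and>
      (\<phi> \<longlongrightarrow> phi0 + pi / 2 * (1 + sgn g1)) at_bot \<and>
      (\<phi> \<longlongrightarrow> pi / 2 * (1 - sgn g1)) at_top \<and>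
      (\<theta> \<longlongrightarrow> 0) at_bot \<and> (\<theta> \<longlongrightarrow> pi / 2) at_top)"
proof (intro notI, elim exE conjE)
  fix \<theta> \<phi> \<psi> :: "real \<Rightarrow> real" and W :: "real \<Rightarrow> cmat3"
  assume sm: "smooth_real \<theta>" "smooth_real \<phi>" "smooth_real \<psi>" "smooth_real W"
    and W: "\<forall>x. W x \<in> SU3" and sol: "domain_wall_solution wp wm Lam g1 \<theta> \<phi> \<psi> W"
    and lim: "(\<psi> \<longlongrightarrow> phi0) at_bot" "(\<psi> \<longlongrightarrow> 0) at_top"
      "(\<phi> \<longlongrightarrow> phi0 + pi / 2 * (1 + sgn g1)) at_bot" "(\<phi> \<longlongrightarrow> pi / 2 * (1 - sgn g1)) at_top"
      "(\<theta> \<longlongrightarrow> 0) at_bot" "(\<theta> \<longlongrightarrow> pi / 2) at_top"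
  \<comment> \<open>Since \<open>g1\<close> is nonzero, the inner root is strictly below 1, which
    makes \<open>wm\<close> positive.\<close>
  have "16 * g1\<^sup>2 * l12\<^sup>2 / (m^4 * Lam\<^sup>2) > 0"
    using assms by (intro divide_pos_pos mult_pos_pos) auto
  then have "sqrt (1 - 16 * g1\<^sup>2 * l12\<^sup>2 / (m^4 * Lam\<^sup>2)) < 1"
    by (simp add: real_sqrt_lt_1_iff)
  then have wm: "wm > 0"
    using assms by (auto intro!: mult_pos_pos divide_pos_pos)
  have "((\<lambda>x. \<phi> x - \<psi> x) has_real_derivative 0) (at x)" for x
    using DERIV_diff[OF smooth_real_has_real_derivative[OF sm(2), of x] smooth_real_has_real_derivative[OF sm(3), of x]]
      phase_difference_constant[OF wm \<open>wp > wm\<close> \<open>g1 \<noteq> 0\<close> sm _ sol lim(4-6), of x] W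
    by simp
  then obtain c where const: "\<phi> x - \<psi> x = c" for x
    using DERIV_isconst_all[of "\<lambda>x. \<phi> x - \<psi> x"] by blast
  \<comment> \<open>The limits of the constant phase difference at the two ends are 0 and pi in an
    order fixed by the sign of \<open>g1\<close>. They agree only if
    \<open>sgn g1 = 0\<close>.\<close>
  have "((\<lambda>x. \<phi> x - \<psi> x) \<longlongrightarrow> pi / 2 * (1 + sgn g1)) at_bot"
    using tendsto_diff[OF lim(3,1)] by simp
  then have "pi / 2 * (1 + sgn g1) = c"
    unfolding const by (simp add: tendsto_const_iff)
  moreover have "((\<lambda>x. \<phi> x - \<psi> x) \<longlongrightarrow> pi / 2 * (1 - sgn g1)) at_top"
    using tendsto_diff[OF lim(4,2)] by simp
  then have "pi / 2 * (1 - sgn g1) = c"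
    unfolding const by (simp add: tendsto_const_iff)
  ultimately show False
    using \<open>g1 \<noteq> 0\<close> by (auto simp: sgn_if split: if_splits)
qed

end
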